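(* Let $G$ be a group, $H\le G$, and $S\subset G$ such that $S\cap H=\emptyset$ and $S=HSH$. Let $n=[G:H]$ (finite, $n\geq 2$) and let $p$ be the smallest prime divisor of $n$. If $\mathrm{Cos}(G,H,S)$ is weakly connected and has no subdigraph isomorphic to $\vec{K}_{p,p}$, then $\mathrm{Aut}(\mathrm{Cos}(G,H,S))$ is $9/8$-closed. Consequently, if $\mathrm{Cos}(G,H,S)$ is a connected graph of girth at least $5$, then $\mathrm{Aut}(\mathrm{Cos}(G,H,S))$ is $9/8$-closed.
   Context: For a group $G$, $H\le G$ and $S\subset G$ with $S\cap H=\emptyset$ and $HSH=S$, the double coset digraph $\mathrm{Cos}(G,H,S)$ has vertex set $G/H$ (left cosets) and arc set $\{(gH,gsH):g\in G,\ s\in S\}$. A digraph is a graph if its arc set is symmetric. $\vec{K}_{m,m}$ is the complete bipartite graph $K_{m,m}$ oriented so that every arc points from one bipartition set to the other. Let $G$ be a transitive permutation group on a finite set $X$. A block of $G$ is a nonempty set $B\subseteq X$ with $g(B)\cap B\in\{\emptyset,B\}$ for all $g\in G$; the partition $\{g(B):g\in G\}$ is a block system of $G$. A block system is normal if it is the set of orbits of a normal subgroup of $G$. $\mathrm{fix}_G(\mathcal{B})=\{g\in G:g(B)=B\text{ for all }B\in\mathcal{B}\}$. If a group $L$ preserves a set $B$, $L^B$ is the permutation group it induces on $B$. For a normal block system $\mathcal{B}$ of $G$ and $B\in\mathcal{B}$, $\mathrm{WStab}_G(B)$ is the largest subgroup $W\le\mathrm{fix}_G(\mathcal{B})$ such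 that $W^B=1$ and, for every other $B'\in\mathcal{B}$, $W^{B'}$ is either transitive on $B'$ or trivial (such a largest subgroup exists). Define $B\equiv B'$ iff $\mathrm{WStab}_G(B)=\mathrm{WStab}_G(B')$. The unions of the equivalence classes of $\equiv$ form a block system $\mathcal{E}_{G,\mathcal{B}}$ of $G$, the $\mathcal{B}$-fixer block system of $G$. If $g(Y)=Y$, $g|_Y$ is the permutation equal to $g$ on $Y$ and the identity off $Y$. $G$ is $5/2$-closed if for every transitive $H\le G$, every normal block system $\mathcal{B}$ of $H$, every $E\in\mathcal{E}_{H,\mathcal{B}}$, and every $g\in G$ fixing setwise each block of $\mathcal{B}$ contained in $E$, one has $g|_E\in G$. A transitive $5/2$-closed group $G$ is $9/8$-closed if $\mathcal{E}_{H,\mathcal{B}}=\{X\}$ for every transitive $H\le G$ and every normal block system $\mathcal{B}$ of $H$. *)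

theory Defs
  imports
    "HOL-Algebra.Group_Action"
    "HOL-Algebra.Left_Coset"
    "HOL-Computational_Algebra.Primes"
    "HOL-Library.Extended_Nat"
    "Graph_Theory.Digraph_Isomorphism"
begin

section \<open>Permutation groups and block systems\<close>

text \<open>A permutation group on \<open>X\<close> is given by its set \<open>G\<close> of elements, a subgroup of
  \<open>BijGroup X\<close>; permutations are thus \<open>undefined\<close> outside \<open>X\<close>.\<close>

abbreviation perm_group :: "'a set \<Rightarrow> ('a \<Rightarrow> 'a) set \<Rightarrow> ('a \<Rightarrow> 'a) monoid" where
  "perm_group X G \<equiv> (BijGroup X)\<lparr>carrier := G\<rparr>"

definition transitive_on :: "'a set \<Rightarrow> ('a \<Rightarrow> 'a) set \<Rightarrow> bool" where
  "transitive_on X G \<longleftrightarrow> transitive_action (perm_group X G) X (\<lambda>g. g)"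

definition trivial_on :: "'a set \<Rightarrow> ('a \<Rightarrow> 'a) set \<Rightarrow> bool" where
  "trivial_on X G \<longleftrightarrow> G = {\<one>\<^bsub>BijGroup X\<^esub>}"

text \<open>The permutation group \<open>L\<^sup>B\<close> that \<open>L\<close> induces on a set \<open>B\<close> preserved by \<open>L\<close>.\<close>

definition induced :: "('a \<Rightarrow> 'a) set \<Rightarrow> 'a set \<Rightarrow> ('a \<Rightarrow> 'a) set" where
  "induced L B = (\<lambda>g. restrict g B) ` L"

definition block :: "'a set \<Rightarrow> ('a \<Rightarrow> 'a) set \<Rightarrow> 'a set \<Rightarrow> bool" where
  "block X G B \<longleftrightarrow> B \<noteq> {} \<and> B \<subseteq> X \<and> (\<forall>g\<in>G. g ` B \<inter> B \<in> {{}, B})"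

definition block_system :: "'a set \<Rightarrow> ('a \<Rightarrow> 'a) set \<Rightarrow> 'a set set \<Rightarrow> bool" where
  "block_system X G \<B> \<longleftrightarrow> (\<exists>B. block X G B \<and> \<B> = {g ` B |g. g \<in> G})"

definition normal_block_system :: "'a set \<Rightarrow> ('a \<Rightarrow> 'a) set \<Rightarrow> 'a set set \<Rightarrow> bool" where
  "normal_block_system X G \<B> \<longleftrightarrow> block_system X G \<B> \<and>
     (\<exists>N. N \<lhd> perm_group X G \<and> \<B> = orbits (perm_group X N) X (\<lambda>g. g))"

definition fix_blocks :: "('a \<Rightarrow> 'a) set \<Rightarrow> 'a set set \<Rightarrow> ('a \<Rightarrow> 'a) set" where
  "fix_blocks G \<B> = {g \<in> G. \<forall>B\<in>\<B>. g ` B = B}"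

definition WStab :: "'a set \<Rightarrow> ('a \<Rightarrow> 'a) set \<Rightarrow> 'a set set \<Rightarrow> 'a set \<Rightarrow> ('a \<Rightarrow> 'a) set" where
  "WStab X G \<B> B =
     (GREATEST W. subgroup W (perm_group X (fix_blocks G \<B>)) \<and>
        trivial_on B (induced W B) \<and>
        (\<forall>B'\<in>\<B>. B' \<noteq> B \<longrightarrow> transitive_on B' (induced W B') \<or> trivial_on B' (induced W B')))"

definition fixer_block_system ::
    "'a set \<Rightarrow> ('a \<Rightarrow> 'a) set \<Rightarrow> 'a set set \<Rightarrow> 'a set set" where
  "fixer_block_system X G \<B> = {\<Union>{B' \<in> \<B>. WStab X G \<B> B = WStab X G \<B> B'} |B. B \<in> \<B>}"

text \<open>\<open>restrict_perm X g Y\<close> is the permutation \<open>g|\<^sub>Y\<close> of \<open>X\<close>, for \<open>g\<close> with \<open>g ` Y = Y\<close>.\<close>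

definition restrict_perm :: "'a set \<Rightarrow> ('a \<Rightarrow> 'a) \<Rightarrow> 'a set \<Rightarrow> 'a \<Rightarrow> 'a" where
  "restrict_perm X g Y = (\<lambda>x\<in>X. if x \<in> Y then g x else x)"

definition five_halves_closed :: "'a set \<Rightarrow> ('a \<Rightarrow> 'a) set \<Rightarrow> bool" where
  "five_halves_closed X G \<longleftrightarrow>
     (\<forall>H \<B> E g. subgroup H (perm_group X G) \<longrightarrow> transitive_on X H \<longrightarrow>
        normal_block_system X H \<B> \<longrightarrow> E \<in> fixer_block_system X H \<B> \<longrightarrow>
        g \<in> G \<longrightarrow> (\<forall>B\<in>\<B>. B \<subseteq> E \<longrightarrow> g ` B = B) \<longrightarrow> restrict_perm X g E \<in> G)"

definition nine_eighths_closed :: "'a set \<Rightarrow> ('a \<Rightarrow> 'a) set \<Rightarrow> bool" where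
  "nine_eighths_closed X G \<longleftrightarrow>
     finite X \<and> subgroup G (BijGroup X) \<and> transitive_on X G \<and> five_halves_closed X G \<and>
     (\<forall>H \<B>. subgroup H (perm_group X G) \<longrightarrow> transitive_on X H \<longrightarrow>
        normal_block_system X H \<B> \<longrightarrow> fixer_block_system X H \<B> = {X})"


section \<open>Digraphs\<close>

definition coset_digraph ::
    "('g, 'm) monoid_scheme \<Rightarrow> 'g set \<Rightarrow> 'g set \<Rightarrow> 'g set pair_pre_digraph" where
  "coset_digraph G H S =
     \<lparr>pverts = lcosets\<^bsub>G\<^esub> H,
      parcs = {(g <#\<^bsub>G\<^esub> H, (g \<otimes>\<^bsub>G\<^esub> s) <#\<^bsub>G\<^esub> H) |g s. g \<in> carrier G \<and> s \<in> S}\<rparr>"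

definition Aut :: "'v pair_pre_digraph \<Rightarrow> ('v \<Rightarrow> 'v) set" where
  "Aut D = {f \<in> Bij (pverts D).
     \<forall>u\<in>pverts D. \<forall>v\<in>pverts D. (f u, f v) \<in> parcs D \<longleftrightarrow> (u, v) \<in> parcs D}"

definition oriented_complete_bipartite :: "nat \<Rightarrow> (nat + nat) pair_pre_digraph" where
  "oriented_complete_bipartite m =
     \<lparr>pverts = {..<m} <+> {..<m}, parcs = (Inl ` {..<m}) \<times> (Inr ` {..<m})\<rparr>"

text \<open>A subdigraph need not be induced.\<close>

definition has_subdigraph_iso :: "'v pair_pre_digraph \<Rightarrow> 'w pair_pre_digraph \<Rightarrow> bool" where
  "has_subdigraph_iso D F \<longleftrightarrow>
     (\<exists>K. subgraph K (with_proj D) \<and> digraph_iso K (with_proj F))"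

text \<open>Girth of a loopless graph, given as a symmetric digraph. The bound on the length excludes
  the directed closed walks \<open>u, v, u\<close> running back and forth along one edge, which count as
  cycles in the library but are not cycles of the graph. The girth of a forest is \<open>\<infinity>\<close>.\<close>

definition girth :: "'v pair_pre_digraph \<Rightarrow> enat" where
  "girth D = (INF c \<in> {c. pre_digraph.cycle (with_proj D) c \<and> 3 \<le> length c}. enat (length c))"

end

theory Submission
  imports Defs
begin

text \<open>If a subgroup of the fixer of a normal block system is trivial on one block and transitive on
  some block with at least two points, then weak connectivity gives an arc between a point \<open>x\<close>
  that it fixes and a point \<open>y\<close> of a block \<open>C\<close> on which it acts transitively. Moving \<open>y\<close>
  joins \<open>x\<close> to all of \<open>C\<close>, and moving \<open>x\<close> by a normal subgroup whose orbits are the blocks joins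
  the whole block of \<open>x\<close> to \<open>C\<close>. As the blocks have the same size, a divisor of \<open>n\<close> greater than
  \<open>1\<close>, this is a copy of the oriented complete bipartite digraph on \<open>p + p\<close> vertices. Without such
  a copy, all groups \<open>WStab\<close> are trivial and there is only one fixer block.
  In a graph, this copy contains a \<open>4\<close>-cycle.\<close>

subsection \<open>Permutation groups\<close>

lemma subgroup_BijGroupD:
  assumes "subgroup L (BijGroup X)" "g \<in> L"
  shows "g \<in> Bij X" "g ` X = X" "inj_on g X"
proof -
  show "g \<in> Bij X"
    using subgroup.subset[OF assms(1)] assms(2) by (auto simp: BijGroup_def)
  then show "g ` X = X" "inj_on g X"
    by (auto simp: Bij_def bij_betw_def)
qed

lemma perm_group_action:
  assumes "subgroup L (BijGroup X)"
  shows "group_action (perm_group X L) X (\<lambda>g. g)"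
proof -
  have "group (perm_group X L)"
    using subgroup.subgroup_is_group[OF assms group_BijGroup] .
  moreover have "(\<lambda>g. g) \<in> hom (perm_group X L) (BijGroup X)"
    using subgroup.subset[OF assms] by (auto simp: hom_def)
  ultimately show ?thesis
    by (simp add: group_action_def group_hom_def group_hom_axioms_def group_BijGroup)
qed

lemma subgroup_perm_group_trans:
  assumes "subgroup H (BijGroup X)" "subgroup L (perm_group X H)"
  shows "subgroup L (BijGroup X)"
  using group.incl_subgroup[OF group_BijGroup assms] .

lemma transitive_onI:
  assumes "subgroup L (BijGroup X)" "\<And>x y. x \<in> X \<Longrightarrow> y \<in> X \<Longrightarrow> \<exists>g\<in>L. g x = y"
  shows "transitive_on X L"
  using perm_group_action[OF assms(1)] assms(2)
  by (simp add: transitive_on_def transitive_action_def transitive_action_axioms_def)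

lemma transitive_onD:
  assumes "transitive_on X L" "x \<in> X" "y \<in> X"
  shows "\<exists>g\<in>L. g x = y"
  using assms transitive_action.unique_orbit[of "perm_group X L" X "\<lambda>g. g" x y]
  by (simp add: transitive_on_def)

lemma transitive_on_inducedD:
  assumes "transitive_on B (induced W B)" "x \<in> B" "y \<in> B"
  shows "\<exists>w\<in>W. w x = y"
  using transitive_onD[OF assms] assms(2) by (auto simp: induced_def)

lemma trivial_on_inducedD:
  assumes "trivial_on B (induced W B)" "w \<in> W" "x \<in> B"
  shows "w x = x"
proof -
  have "restrict w B = (\<lambda>x\<in>B. x)"
    using assms(1,2) by (auto simp: trivial_on_def induced_def BijGroup_def)
  then show ?thesis
    using assms(3) by (metis restrict_apply')
qed

subsection \<open>Normal block systems\<close>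

text \<open>This keeps the part of normality that the main argument uses: a single \<open>N\<close>
  inside \<open>H\<close> moves a point anywhere in its block while mapping every block into
  itself.\<close>

lemma normal_block_systemD:
  assumes "subgroup H (BijGroup X)" "normal_block_system X H \<B>"
  obtains N where "N \<subseteq> H" "partition X \<B>"
    "\<And>B x y. B \<in> \<B> \<Longrightarrow> x \<in> B \<Longrightarrow> y \<in> B \<Longrightarrow> \<exists>g\<in>N. g x = y"
    "\<And>B x g. B \<in> \<B> \<Longrightarrow> x \<in> B \<Longrightarrow> g \<in> N \<Longrightarrow> g x \<in> B"
proof -
  obtain N where N: "N \<lhd> perm_group X H" and \<B>: "\<B> = orbits (perm_group X N) X (\<lambda>g. g)"
    using assms(2) by (auto simp: normal_block_system_def)
  have sub: "subgroup N (perm_group X H)"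
    using N by (simp add: normal_imp_subgroup)
  then have "subgroup N (BijGroup X)"
    by (rule subgroup_perm_group_trans[OF assms(1)])
  then interpret N: group_action "perm_group X N" X "\<lambda>g. g"
    by (rule perm_group_action)
  have part: "partition X \<B>"
    using N.orbit_partition \<B> by simp
  \<comment> \<open>The orbit of \<open>x\<close> is itself a block and contains \<open>x\<close>,
    so uniqueness in the partition identifies it with \<open>B\<close>. Any point of a block may
    thus serve as base point.\<close>
  have B_orbit: "B = {g x |g. g \<in> N}" if "B \<in> \<B>" "x \<in> B" for B x
  proof -
    have "x \<in> X"
      using part that by (auto simp: partition_def)
    then have "x \<in> orbit (perm_group X N) (\<lambda>g. g) x" "orbit (perm_group X N) (\<lambda>g. g) x \<in> \<B>"
      using N.orbit_refl \<B> by (auto simp: orbits_def)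
    then have "B = orbit (perm_group X N) (\<lambda>g. g) x"
      using part that \<open>x \<in> X\<close> unfolding partition_def by blast
    then show ?thesis
      by (simp add: orbit_def)
  qed
  show ?thesis
  proof (rule that)
    show "N \<subseteq> H"
      using subgroup.subset[OF sub] by simp
    show "partition X \<B>"
      by (rule part)
    show "\<exists>g\<in>N. g x = y" if "B \<in> \<B>" "x \<in> B" "y \<in> B" for B x y
      using B_orbit[OF that(1,2)] that(3) by blast
    show "g x \<in> B" if "B \<in> \<B>" "x \<in> B" "g \<in> N" for B x g
      using B_orbit[OF that(1,2)] that(3) by blast
  qed
qed

lemma partition_Union: "partition X \<B> \<Longrightarrow> \<Union>\<B> = X"
  unfolding partition_def by blast

lemma partition_disjoint:
  "partition X \<B> \<Longrightarrow> B \<in> \<B> \<Longrightarrow> C \<in> \<B> \<Longrightarrow> x \<in> B \<Longrightarrow> x \<in> C \<Longrightarrow> B = C"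
  unfolding partition_def by blast

text \<open>All blocks are images of one block \<open>A\<close> under injective maps.\<close>

lemma block_system_card_eq:
  assumes "subgroup H (BijGroup X)" "block_system X H \<B>" "B \<in> \<B>" "C \<in> \<B>"
  shows "card B = card C"
proof -
  obtain A where "A \<subseteq> X" "\<B> = {g ` A |g. g \<in> H}"
    using assms(2) by (auto simp: block_system_def block_def)
  then have "card D = card A" if "D \<in> \<B>" for D
    using that subgroup_BijGroupD(3)[OF assms(1)] by (auto intro!: card_image intro: inj_on_subset)
  then show ?thesis
    using assms(3,4) by metis
qed

text \<open>The blocks partition \<open>X\<close> into parts of equal size. This is what makes a
  block with at least two points have at least \<open>p\<close> points.\<close>

lemma block_card_dvd:
  assumes "subgroup H (BijGroup X)" "normal_block_system X H \<B>" "finite X" "B \<in> \<B>"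
  shows "card B dvd card X"
proof -
  have bs: "block_system X H \<B>"
    using assms(2) by (simp add: normal_block_system_def)
  have part: "partition X \<B>"
    using normal_block_systemD[OF assms(1,2)] by metis
  then have "\<Union>\<B> = X"
    by (rule partition_Union)
  moreover have "card B * card \<B> = card (\<Union>\<B>)"
  proof (rule card_partition)
    show "finite \<B>" "finite (\<Union>\<B>)"
      using \<open>\<Union>\<B> = X\<close> assms(3) by (auto simp: finite_UnionD)
    show "card C = card B" if "C \<in> \<B>" for C
      using block_system_card_eq[OF assms(1) bs that assms(4)] .
    show "C \<inter> D = {}" if "C \<in> \<B>" "D \<in> \<B>" "C \<noteq> D" for C D
      using partition_disjoint[OF part that(1,2)] that(3) by blast
  qed
  ultimately show ?thesis
    by (metis dvd_triv_left)
qed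

text \<open>\<open>GREATEST\<close> refers to inclusion of sets here. The trivial subgroup satisfies
  the defining conditions, and by \<open>triv\<close> it is the only one that does.\<close>

lemma WStab_eq_trivial:
  assumes "subgroup H (BijGroup X)" "\<Union>\<B> = X" "B \<in> \<B>"
    and triv: "\<And>W. subgroup W (perm_group X (fix_blocks H \<B>)) \<Longrightarrow>
      trivial_on B (induced W B) \<Longrightarrow>
      (\<And>C. C \<in> \<B> \<Longrightarrow> transitive_on C (induced W C) \<or> trivial_on C (induced W C)) \<Longrightarrow>
      W = {\<lambda>x\<in>X. x}"
  shows "WStab X H \<B> B = {\<lambda>x\<in>X. x}"
  unfolding WStab_def
proof (rule Greatest_equality)
  have triv_on: "trivial_on C (induced {\<lambda>x\<in>X. x} C)" if "C \<in> \<B>" for C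
  proof -
    have "restrict (\<lambda>x\<in>X. x) C = (\<lambda>x\<in>C. x)"
      using that assms(2) by (auto simp: restrict_def fun_eq_iff)
    then show ?thesis
      by (simp add: trivial_on_def induced_def BijGroup_def)
  qed
  have "(\<lambda>x\<in>X. x) \<in> H"
    using subgroup.one_closed[OF assms(1)] by (simp add: BijGroup_def)
  moreover have "(\<lambda>x\<in>X. x) ` C = C" if "C \<in> \<B>" for C
    using that assms(2) by force
  ultimately have fix_one: "(\<lambda>x\<in>X. x) \<in> fix_blocks H \<B>"
    by (simp add: fix_blocks_def)
  have fix_Bij: "fix_blocks H \<B> \<subseteq> Bij X"
    using subgroup_BijGroupD(1)[OF assms(1)] by (auto simp: fix_blocks_def)
  let ?F = "perm_group X (fix_blocks H \<B>)"
  have one: "\<one>\<^bsub>?F\<^esub> = (\<lambda>x\<in>X. x)"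
    by (simp add: BijGroup_def)
  have oo: "(\<lambda>x\<in>X. x) \<otimes>\<^bsub>?F\<^esub> (\<lambda>x\<in>X. x) = (\<lambda>x\<in>X. x)"
    by (simp add: BijGroup_def id_Bij compose_def fun_eq_iff)
  \<comment> \<open>No group structure on \<open>fix_blocks H \<B>\<close> has been established at
    this point, so the inverse is computed directly from its definition by a description.\<close>
  have inv: "inv\<^bsub>?F\<^esub> (\<lambda>x\<in>X. x) = (\<lambda>x\<in>X. x)"
    unfolding m_inv_def one
  proof (rule the_equality)
    show "(\<lambda>x\<in>X. x) \<in> carrier ?F \<and> (\<lambda>x\<in>X. x) \<otimes>\<^bsub>?F\<^esub> (\<lambda>x\<in>X. x) = (\<lambda>x\<in>X. x) \<and>
        (\<lambda>x\<in>X. x) \<otimes>\<^bsub>?F\<^esub> (\<lambda>x\<in>X. x) = (\<lambda>x\<in>X. x)"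
      using oo fix_one by simp
    show "y = (\<lambda>x\<in>X. x)" if "y \<in> carrier ?F \<and> (\<lambda>x\<in>X. x) \<otimes>\<^bsub>?F\<^esub> y = (\<lambda>x\<in>X. x) \<and>
        y \<otimes>\<^bsub>?F\<^esub> (\<lambda>x\<in>X. x) = (\<lambda>x\<in>X. x)" for y
    proof -
      have "y \<in> Bij X"
        using that fix_Bij by auto
      then have "y \<otimes>\<^bsub>?F\<^esub> (\<lambda>x\<in>X. x) = y"
        using compose_Id[OF Bij_imp_funcset Bij_imp_extensional] by (simp add: BijGroup_def id_Bij)
      then show ?thesis
        using that by simp
    qed
  qed
  have "subgroup {\<lambda>x\<in>X. x} ?F"
  proof (rule subgroup.intro)
    show "{\<lambda>x\<in>X. x} \<subseteq> carrier ?F"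
      using fix_one by simp
    show "x \<otimes>\<^bsub>?F\<^esub> y \<in> {\<lambda>x\<in>X. x}" if "x \<in> {\<lambda>x\<in>X. x}" "y \<in> {\<lambda>x\<in>X. x}" for x y
      using that oo by (metis singleton_iff)
    show "\<one>\<^bsub>?F\<^esub> \<in> {\<lambda>x\<in>X. x}"
      unfolding one by (rule singletonI)
    show "inv\<^bsub>?F\<^esub> x \<in> {\<lambda>x\<in>X. x}" if "x \<in> {\<lambda>x\<in>X. x}" for x
      using that inv by (metis singleton_iff)
  qed
  then show "subgroup {\<lambda>x\<in>X. x} ?F \<and> trivial_on B (induced {\<lambda>x\<in>X. x} B) \<and>
      (\<forall>B'\<in>\<B>. B' \<noteq> B \<longrightarrow> transitive_on B' (induced {\<lambda>x\<in>X. x} B') \<or>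
        trivial_on B' (induced {\<lambda>x\<in>X. x} B'))"
    using triv_on assms(3) by blast
  show "W \<le> {\<lambda>x\<in>X. x}" if "subgroup W ?F \<and> trivial_on B (induced W B) \<and>
      (\<forall>B'\<in>\<B>. B' \<noteq> B \<longrightarrow> transitive_on B' (induced W B') \<or> trivial_on B' (induced W B'))" for W
  proof -
    \<comment> \<open>The definition of \<open>WStab\<close> exempts \<open>B\<close> from the
      dichotomy, but triviality on \<open>B\<close> supplies it there.\<close>
    have "transitive_on C (induced W C) \<or> trivial_on C (induced W C)" if "C \<in> \<B>" for C
      using \<open>subgroup W ?F \<and> _\<close> that by (cases "C = B") auto
    then have "W = {\<lambda>x\<in>X. x}"
      using that by (intro triv) auto
    then show ?thesis
      by simp
  qed
qed

subsection \<open>Digraphs\<close>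

text \<open>A path in the symmetric closure that starts in \<open>T\<close> and ends outside must
  leave \<open>T\<close> at some step. The underlying arc of \<open>D\<close> may point either way,
  hence the equivalence in the conclusion.\<close>

lemma connected_crossing_arc:
  assumes "connected (with_proj D)" "x \<in> pverts D" "y \<in> pverts D" "x \<in> T" "y \<notin> T"
  obtains u v where "(u, v) \<in> parcs D" "u \<in> T \<longleftrightarrow> v \<notin> T"
proof -
  have "x \<rightarrow>\<^sup>*\<^bsub>with_proj (mk_symmetric (with_proj D))\<^esub> y"
    using assms(1-3) by (auto simp: connected_def strongly_connected_def)
  then have "(x, y) \<in> (parcs (mk_symmetric (with_proj D)))\<^sup>*"
    using reachable_rtranclI by fastforce
  then have "\<exists>u v. (u, v) \<in> parcs (mk_symmetric (with_proj D)) \<and> u \<in> T \<and> v \<notin> T"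
    using assms(4,5) by (induction rule: converse_rtrancl_induct) auto
  then show ?thesis
    using that by (auto simp: parcs_mk_symmetric)
qed

text \<open>Choose \<open>m\<close> vertices on each side. Disjointness of \<open>A\<close> and
  \<open>B\<close> makes the combined vertex map \<open>h\<close> injective, and the required
  subdigraph is the image of the model under \<open>h\<close>.\<close>

lemma has_subdigraph_iso_oriented_complete_bipartite:
  assumes "wf_digraph (with_proj D)" "A \<subseteq> pverts D" "B \<subseteq> pverts D" "A \<inter> B = {}"
    and "A \<times> B \<subseteq> parcs D" "finite A" "finite B" "m \<le> card A" "m \<le> card B"
  shows "has_subdigraph_iso D (oriented_complete_bipartite m)"
proof -
  obtain a where a: "a ` {..<m} \<subseteq> A" "inj_on a {..<m}"
    using card_le_inj[of "{..<m}" A] assms by auto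
  obtain b where b: "b ` {..<m} \<subseteq> B" "inj_on b {..<m}"
    using card_le_inj[of "{..<m}" B] assms by auto
  let ?F = "oriented_complete_bipartite m"
  define h where "h = case_sum a b"
  \<comment> \<open>Arcs are pairs of vertices, so \<open>h\<close> acts on both components. The
    projections are kept as tail and head maps to make the image compatible with
    \<open>with_proj D\<close>.\<close>
  define f where "f = \<lparr>iso_verts = h, iso_arcs = map_prod h h, iso_head = snd, iso_tail = fst\<rparr>"
  interpret F: wf_digraph "with_proj ?F"
    by unfold_locales (auto simp: oriented_complete_bipartite_def)
  have ab: "a i \<in> A" "b i \<in> B" if "i < m" for i
    using a(1) b(1) that by auto
  then have "a i \<noteq> b j" if "i < m" "j < m" for i j
    using assms(4) that by (metis disjoint_iff)
  then have h: "inj_on h (pverts ?F)"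
    using a(2) b(2)
    by (auto simp: inj_on_def h_def oriented_complete_bipartite_def split: sum.splits) metis
  have "inj_on (map_prod h h) (parcs ?F)"
  proof (rule inj_on_subset)
    show "inj_on (map_prod h h) (pverts ?F \<times> pverts ?F)"
      using h h by (rule map_prod_inj_on)
    show "parcs ?F \<subseteq> pverts ?F \<times> pverts ?F"
      using F.wellformed by auto
  qed
  then have f: "pre_digraph.digraph_isomorphism (with_proj ?F) f"
    using h by (simp add: pre_digraph.digraph_isomorphism_def F.wf_digraph f_def)
  let ?K = "app_iso f (with_proj ?F)"
  have "subgraph ?K (with_proj D)"
    unfolding subgraph_def compatible_def
  proof (intro conjI)
    show "verts ?K \<subseteq> verts (with_proj D)"
      using ab assms(2,3) by (auto simp: f_def h_def oriented_complete_bipartite_def)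
    show "arcs ?K \<subseteq> arcs (with_proj D)"
      using ab assms(5) by (auto simp: f_def h_def oriented_complete_bipartite_def)
    show "wf_digraph ?K"
      using f by (rule F.wf_digraphI_app_iso)
  qed (use assms(1) in \<open>simp_all add: f_def\<close>)
  \<comment> \<open>The isomorphism is wanted from the copy to the model, so the inverse of
    \<open>f\<close> is used.\<close>
  moreover have "digraph_iso ?K (with_proj ?F)"
    unfolding digraph_iso_def
    using F.digraph_isomorphism_invI[OF f] F.app_iso_inv[OF f, symmetric] by blast
  ultimately show ?thesis
    unfolding has_subdigraph_iso_def by blast
qed

text \<open>Two vertices on each side of the copy span a closed walk that alternates between the
  sides. Symmetry supplies the arcs leading back.\<close>

lemma girth_le_4_if_oriented_complete_bipartite:
  assumes "symmetric (with_proj D)" "has_subdigraph_iso D (oriented_complete_bipartite m)" "2 \<le> m"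
  shows "girth D \<le> 4"
proof -
  let ?F = "oriented_complete_bipartite m"
  obtain K f where K: "subgraph K (with_proj D)"
    and f: "pre_digraph.digraph_isomorphism K f" "with_proj ?F = app_iso f K"
    using assms(2) by (auto simp: has_subdigraph_iso_def digraph_iso_def)
  have "verts (with_proj ?F) = verts (app_iso f K)" "arcs (with_proj ?F) = arcs (app_iso f K)"
    and "tail (with_proj ?F) = tail (app_iso f K)" "head (with_proj ?F) = head (app_iso f K)"
    by (simp_all only: f(2))
  then have verts: "pverts ?F = iso_verts f ` verts K" and arcs: "parcs ?F = iso_arcs f ` arcs K"
    and t: "iso_tail f = fst" "iso_head f = snd"
    by simp_all
  \<comment> \<open>The inverse of the vertex isomorphism carries vertices of the model to vertices
    of the copy \<open>K\<close>.\<close>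
  define g where "g = the_inv_into (verts K) (iso_verts f)"
  have inj: "inj_on (iso_verts f) (verts K)"
    using f(1) by (simp add: pre_digraph.digraph_isomorphism_def)
  have arc: "(g (Inl i), g (Inr j)) \<in> parcs D" if "i < m" "j < m" for i j
  proof -
    have "(Inl i, Inr j) \<in> parcs ?F"
      using that by (simp add: oriented_complete_bipartite_def)
    then obtain e where e: "e \<in> arcs K" "iso_arcs f e = (Inl i, Inr j)"
      unfolding arcs by (metis imageE)
    have K': "arcs K \<subseteq> parcs D" "tail K = fst" "head K = snd" "wf_digraph K"
      using K by (simp_all add: subgraph_def compatible_def)
    have "iso_verts f (fst e) = Inl i" "iso_verts f (snd e) = Inr j"
      using pre_digraph.iso_verts_tail[OF f(1) e(1)] pre_digraph.iso_verts_head[OF f(1) e(1)] e(2)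
        K'(2,3) t by simp_all
    moreover have "fst e \<in> verts K" "snd e \<in> verts K"
      using wf_digraph.wellformed[OF K'(4) e(1)] K'(2,3) by auto
    ultimately have "g (Inl i) = fst e" "g (Inr j) = snd e"
      using the_inv_into_f_f[OF inj, of "fst e"] the_inv_into_f_f[OF inj, of "snd e"]
      by (simp_all add: g_def)
    then show ?thesis
      using e(1) K'(1) by auto
  qed
  then have arc': "(g (Inr j), g (Inl i)) \<in> parcs D" if "i < m" "j < m" for i j
    using arc[OF that] assms(1) by (simp add: symmetric_def sym_def)
  have g_inj: "inj_on g (pverts ?F)" and g_in: "g ` pverts ?F = verts K"
    using inj_on_the_inv_into[OF inj] the_inv_into_onto[OF inj] verts by (simp_all add: g_def)
  have "{Inl 0, Inr 0, Inl 1, Inr 1} \<subseteq> pverts ?F"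
    using assms(3) by (auto simp: oriented_complete_bipartite_def)
  then have dist: "distinct [g (Inl 0), g (Inr 0), g (Inl 1), g (Inr 1)]"
    using inj_on_eq_iff[OF g_inj] by simp
  let ?c = "[(g (Inl 0), g (Inr 0)), (g (Inr 0), g (Inl 1)), (g (Inl 1), g (Inr 1)), (g (Inr 1), g (Inl 0))]"
  have "Inl 0 \<in> pverts ?F"
    using assms(3) by (auto simp: oriented_complete_bipartite_def)
  then have "g (Inl 0) \<in> verts K"
    using g_in by blast
  then have "g (Inl 0) \<in> pverts D"
    using subgraph_imp_subverts[OF K] by auto
  moreover have "set ?c \<subseteq> parcs D"
    using arc[of 0 0] arc'[of 0 1] arc[of 1 1] arc'[of 1 0] assms(3) by simp
  ultimately have "pre_digraph.cycle (with_proj D) ?c"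
    unfolding pre_digraph.cycle_def pre_digraph.awalk_def cas_with_proj_eq awalk_verts_with_proj_eq
    using dist by (intro exI[of _ "g (Inl 0)"]) auto
  then have "girth D \<le> enat (length ?c)"
    unfolding girth_def by (intro INF_lower) auto
  also have "enat (length ?c) = 4"
    by (simp add: numeral_eq_enat)
  finally show ?thesis .
qed

section \<open>The automorphism group of a digraph\<close>

lemma subgroup_Aut: "subgroup (Aut D) (BijGroup (pverts D))"
proof (rule group.subgroupI[OF group_BijGroup])
  show "Aut D \<subseteq> carrier (BijGroup (pverts D))"
    by (auto simp: Aut_def BijGroup_def)
  have "(\<lambda>x\<in>pverts D. x) \<in> Aut D"
    by (simp add: Aut_def id_Bij)
  then show "Aut D \<noteq> {}"
    by blast
  show "inv\<^bsub>BijGroup (pverts D)\<^esub> f \<in> Aut D" if "f \<in> Aut D" for f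
  proof -
    have f: "f \<in> Bij (pverts D)"
      and iff: "\<And>u v. u \<in> pverts D \<Longrightarrow> v \<in> pverts D \<Longrightarrow> (f u, f v) \<in> parcs D \<longleftrightarrow> (u, v) \<in> parcs D"
      using that by (auto simp: Aut_def)
    have "f (inv_into (pverts D) f u) = u" if "u \<in> pverts D" for u
      using f that by (auto simp: Bij_def bij_betw_def f_inv_into_f)
    then show ?thesis
      using iff[OF Bij_inv_into_mem Bij_inv_into_mem, OF f _ f] f
      by (simp add: inv_BijGroup Aut_def restrict_inv_into_Bij)
  qed
  show "f \<otimes>\<^bsub>BijGroup (pverts D)\<^esub> g \<in> Aut D" if "f \<in> Aut D" "g \<in> Aut D" for f g
    using that funcset_mem[OF Bij_imp_funcset, of g]
    by (simp add: Aut_def BijGroup_def compose_Bij compose_eq)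
qed

subsection \<open>Complete bipartite subdigraphs between blocks\<close>

lemma complete_bipartite_between_blocks:
  assumes wf: "wf_digraph (with_proj D)" and con: "connected (with_proj D)"
    and fin: "finite (pverts D)"
    and H: "subgroup H (BijGroup (pverts D))" "H \<subseteq> Aut D"
    and \<B>: "normal_block_system (pverts D) H \<B>"
    and W: "W \<subseteq> fix_blocks H \<B>" "B \<in> \<B>" "trivial_on B (induced W B)"
      "\<And>C. C \<in> \<B> \<Longrightarrow> transitive_on C (induced W C) \<or> trivial_on C (induced W C)"
    and nontriv: "w \<in> W" "w \<noteq> (\<lambda>x\<in>pverts D. x)"
  obtains B C where "B \<in> \<B>" "C \<in> \<B>" "B \<inter> C = {}" "B \<times> C \<subseteq> parcs D" "2 \<le> card B"
proof -
  let ?X = "pverts D"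
  obtain N where N: "N \<subseteq> H" and part: "partition ?X \<B>"
    and N_trans: "\<And>B x y. B \<in> \<B> \<Longrightarrow> x \<in> B \<Longrightarrow> y \<in> B \<Longrightarrow> \<exists>g\<in>N. g x = y"
    and N_block: "\<And>B x g. B \<in> \<B> \<Longrightarrow> x \<in> B \<Longrightarrow> g \<in> N \<Longrightarrow> g x \<in> B"
    using normal_block_systemD[OF H(1) \<B>] by metis
  have BX: "C \<subseteq> ?X" if "C \<in> \<B>" for C
    using partition_Union[OF part] that by blast
  have H_arc: "(h u, h v) \<in> parcs D \<longleftrightarrow> (u, v) \<in> parcs D" if "h \<in> H" "u \<in> ?X" "v \<in> ?X" for h u v
    using that H(2) by (auto simp: Aut_def)
  have WH: "w \<in> H" if "w \<in> W" for w
    using that W(1) by (auto simp: fix_blocks_def)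
  have W_block: "w ` C = C" if "w \<in> W" "C \<in> \<B>" for w C
    using that W(1) by (auto simp: fix_blocks_def)
  have arcX: "u \<in> ?X" "v \<in> ?X" if "(u, v) \<in> parcs D" for u v
    using wf_digraph.wellformed[OF wf, of "(u, v)"] that by auto
  \<comment> \<open>Elements of \<open>N\<close> are only known to map \<open>C\<close> into
    \<open>C\<close>; finiteness and injectivity make them surjective on \<open>C\<close>.\<close>
  have N_onto: "\<exists>z\<in>C. g z = y" if C: "C \<in> \<B>" and y: "y \<in> C" and g: "g \<in> N" for C y g
  proof -
    have "finite C" "inj_on g C"
      using BX[OF C] fin subgroup_BijGroupD(3)[OF H(1)] g N
      by (auto intro: finite_subset inj_on_subset)
    then have "g ` C = C"
      using N_block[OF C _ g] by (intro endo_inj_surj) auto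
    then show ?thesis
      using y by (metis imageE)
  qed
  \<comment> \<open>The common fixed points of \<open>W\<close>. By \<open>trans\<close> and
    \<open>disj\<close> below, a block with a point outside \<open>T\<close> has no point in
    \<open>T\<close>, so an arc crossing the boundary of \<open>T\<close> joins different
    blocks.\<close>
  define T where "T = {x \<in> ?X. \<forall>w\<in>W. w x = x}"
  have trans: "transitive_on C (induced W C)" if "C \<in> \<B>" "v \<in> C" "v \<notin> T" for C v
    using that W(4)[OF that(1)] trivial_on_inducedD BX[OF that(1)] by (fastforce simp: T_def)
  have "B \<noteq> {}"
    using W(2) \<B> by (auto simp: normal_block_system_def block_system_def block_def)
  then obtain x0 where x0: "x0 \<in> ?X" "x0 \<in> T"
    using trivial_on_inducedD[OF W(3)] BX[OF W(2)] by (auto simp: T_def)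
  obtain y0 where y0: "y0 \<in> ?X" "y0 \<notin> T"
  proof -
    \<comment> \<open>Both \<open>w\<close> and the identity are \<open>undefined\<close> off
      \<open>?X\<close>, so they must differ at a point of \<open>?X\<close>.\<close>
    have "w \<in> extensional ?X"
      using subgroup_BijGroupD(1)[OF H(1) WH[OF nontriv(1)]] by (rule Bij_imp_extensional)
    then have "\<exists>y\<in>?X. w y \<noteq> y"
      using nontriv(2) by (metis extensionalityI restrict_apply' restrict_extensional)
    then show ?thesis
      using that nontriv(1) by (auto simp: T_def)
  qed
  have card2: "2 \<le> card C" if C: "C \<in> \<B>" "v \<in> C" "v \<notin> T" for C v
  proof -
    obtain w where "w \<in> W" "w v \<noteq> v"
      using C BX by (auto simp: T_def)
    moreover from this have "w v \<in> C"
      using W_block C by blast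
    moreover have "finite C"
      using BX[OF C(1)] fin by (rule finite_subset)
    ultimately show ?thesis
      using C(2) card_mono[of C "{v, w v}"] by auto
  qed
  have disj: "A \<inter> C = {}" 
    if "A \<in> \<B>" and C: "C \<in> \<B>" "v \<in> C" "v \<notin> T" and u: "u \<in> A" "u \<in> T" for A C u v
  proof (rule ccontr)
    assume "A \<inter> C \<noteq> {}"
    \<comment> \<open>Blocks that meet are equal. An element of \<open>W\<close> would then carry
      the fixed point \<open>u\<close> to \<open>v\<close>, forcing \<open>v = u\<close>.\<close>
    then have "u \<in> C"
      using partition_disjoint[OF part that(1,2)] u(1) by blast
    then obtain w where "w \<in> W" "w u = v"
      using transitive_on_inducedD[OF trans[OF C]] C(2) by blast
    then have "v = u"
      using u(2) unfolding T_def by blast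
    then show False
      using u(2) C(3) by simp
  qed
  obtain u v where uv: "(u, v) \<in> parcs D" "u \<in> T \<longleftrightarrow> v \<notin> T"
    using connected_crossing_arc[OF con x0(1) y0(1) x0(2) y0(2)] .
  obtain A where A: "A \<in> \<B>" "u \<in> A"
    using arcX[OF uv(1)] part unfolding partition_def by blast
  obtain C where C: "C \<in> \<B>" "v \<in> C"
    using arcX[OF uv(1)] part unfolding partition_def by blast
  \<comment> \<open>If \<open>u\<close> lies in \<open>T\<close>, the block moved by
    \<open>W\<close> is \<open>C\<close>, whereas the size bound is claimed for the tail block
    \<open>A\<close>.\<close>
  have card_eq: "card A = card C"
    using block_system_card_eq[OF H(1)] \<B> A C by (auto simp: normal_block_system_def)
  show ?thesis
  proof (cases "u \<in> T")
    case True
    then have v: "v \<notin> T"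
      using uv(2) by simp
    \<comment> \<open>\<open>W\<close> fixes \<open>u\<close> while carrying \<open>v\<close> to any
      point of \<open>C\<close>.\<close>
    have u_all: "(u, y) \<in> parcs D" if y: "y \<in> C" for y
    proof -
      obtain w where "w \<in> W" "w v = y"
        using transitive_on_inducedD[OF trans[OF C v]] C(2) y by blast
      moreover from this have "w u = u"
        using True by (auto simp: T_def)
      ultimately show ?thesis
        using H_arc[OF WH arcX[OF uv(1)]] uv(1) by metis
    qed
    \<comment> \<open>Some \<open>g\<close> in \<open>N\<close> takes \<open>u\<close> to
      \<open>x\<close> and preserves \<open>C\<close>, so the arc from \<open>x\<close> to
      \<open>y\<close> is the image under \<open>g\<close> of an arc from \<open>u\<close> to a
      point of \<open>C\<close>.\<close>
    have "(x, y) \<in> parcs D" if x: "x \<in> A" and y: "y \<in> C" for x y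
    proof -
      obtain g where g: "g \<in> N" "g u = x"
        using N_trans A x by blast
      obtain z where "z \<in> C" "g z = y"
        using N_onto C(1) y g(1) by blast
      then show ?thesis
        using H_arc[of g u z] u_all g N arcX[OF uv(1)] BX[OF C(1)] by blast
    qed
    then show ?thesis
      using that[OF A(1) C(1)] disj[OF A(1) C v A(2) True] card2[OF C v] card_eq by auto
  \<comment> \<open>The mirror case: \<open>W\<close> now fixes the head \<open>v\<close> and moves
    the tail \<open>u\<close> through all of \<open>A\<close>.\<close>
  next
    case False
    then have v: "v \<in> T"
      using uv(2) by simp
    have all_v: "(x, v) \<in> parcs D" if x: "x \<in> A" for x
    proof -
      obtain w where "w \<in> W" "w u = x"
        using transitive_on_inducedD[OF trans[OF A False]] A(2) x by blast
      moreover from this have "w v = v"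
        using v by (auto simp: T_def)
      ultimately show ?thesis
        using H_arc[OF WH arcX[OF uv(1)]] uv(1) by metis
    qed
    have "(x, y) \<in> parcs D" if x: "x \<in> A" and y: "y \<in> C" for x y
    proof -
      obtain g where g: "g \<in> N" "g v = y"
        using N_trans C y by blast
      obtain z where "z \<in> A" "g z = x"
        using N_onto A(1) x g(1) by blast
      then show ?thesis
        using H_arc[of g z v] all_v g N arcX[OF uv(1)] BX[OF A(1)] by blast
    qed
    then show ?thesis
      using that[OF A(1) C(1)] disj[OF C(1) A False C(2) v] card2[OF A False] by auto
  qed
qed

section \<open>From forbidden bipartite subdigraphs to \<open>9/8\<close>-closure\<close>

lemma least_prime_divisor_le:
  fixes k n p :: nat
  assumes "k dvd n" "2 \<le> k" "p = (LEAST q. prime q \<and> q dvd n)"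
  shows "p \<le> k"
proof -
  obtain q where "prime q" "q dvd k"
    using prime_factor_nat[of k] assms(2) by auto
  then have "p \<le> q"
    using assms(1,3) by (auto intro: Least_le dvd_trans)
  also have "q \<le> k"
    using \<open>q dvd k\<close> assms(2) by (auto intro: dvd_imp_le)
  finally show ?thesis .
qed

text \<open>A nonidentity element of a candidate for \<open>WStab\<close> would yield a forbidden
  subdigraph between two blocks. Hence all weak stabilizers are trivial, and therefore equal, and
  the equivalence on blocks has a single class.\<close>

lemma fixer_block_system_Aut:
  assumes wf: "wf_digraph (with_proj D)" and con: "connected (with_proj D)"
    and fin: "finite (pverts D)"
    and p: "p = (LEAST q. prime q \<and> q dvd card (pverts D))"
    and free: "\<not> has_subdigraph_iso D (oriented_complete_bipartite p)"
    and H: "subgroup H (perm_group (pverts D) (Aut D))"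
    and \<B>: "normal_block_system (pverts D) H \<B>"
  shows "fixer_block_system (pverts D) H \<B> = {pverts D}"
proof -
  let ?X = "pverts D"
  have HB: "subgroup H (BijGroup ?X)"
    using subgroup_perm_group_trans[OF subgroup_Aut H] .
  have HA: "H \<subseteq> Aut D"
    using subgroup.subset[OF H] by simp
  have U: "\<Union>\<B> = ?X"
    using normal_block_systemD[OF HB \<B>] partition_Union by metis
  have "WStab ?X H \<B> B = {\<lambda>x\<in>?X. x}" if B: "B \<in> \<B>" for B
    using HB U B
  proof (rule WStab_eq_trivial)
    fix W
    assume W: "subgroup W (perm_group ?X (fix_blocks H \<B>))" "trivial_on B (induced W B)"
      "\<And>C. C \<in> \<B> \<Longrightarrow> transitive_on C (induced W C) \<or> trivial_on C (induced W C)"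
    have WF: "W \<subseteq> fix_blocks H \<B>"
      using subgroup.subset[OF W(1)] by simp
    have "(\<lambda>x\<in>?X. x) \<in> W"
      using subgroup.one_closed[OF W(1)] by (simp add: BijGroup_def)
    moreover have "w = (\<lambda>x\<in>?X. x)" if w: "w \<in> W" for w
    proof (rule ccontr)
      assume "w \<noteq> (\<lambda>x\<in>?X. x)"
      then obtain A C where AC: "A \<in> \<B>" "C \<in> \<B>" "A \<inter> C = {}" "A \<times> C \<subseteq> parcs D" "2 \<le> card A"
        using complete_bipartite_between_blocks[OF wf con fin HB HA \<B> WF B W(2,3) w] by metis
      have "p \<le> card A"
        using block_card_dvd[OF HB \<B> fin AC(1)] AC(5) p by (rule least_prime_divisor_le)
      moreover have "card C = card A"
        using block_system_card_eq[OF HB] \<B> AC by (auto simp: normal_block_system_def)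
      moreover have "A \<subseteq> ?X" "C \<subseteq> ?X"
        using U AC(1,2) by auto
      ultimately have "has_subdigraph_iso D (oriented_complete_bipartite p)"
        using has_subdigraph_iso_oriented_complete_bipartite[OF wf _ _ AC(3,4)] fin
        by (metis finite_subset)
      then show False
        using free by contradiction
    qed
    ultimately show "W = {\<lambda>x\<in>?X. x}"
      by blast
  qed
  then have "{B' \<in> \<B>. WStab ?X H \<B> B = WStab ?X H \<B> B'} = \<B>" if "B \<in> \<B>" for B
    using that by auto
  then have "\<Union>{B' \<in> \<B>. WStab ?X H \<B> B = WStab ?X H \<B> B'} = ?X" if "B \<in> \<B>" for B
    using that U by simp
  \<comment> \<open>Without a block there would be no class at all, rather than the one class with
    union \<open>?X\<close>.\<close>
  moreover have "\<B> \<noteq> {}"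
    using \<B> HB subgroup.one_closed
    by (fastforce simp: normal_block_system_def block_system_def)
  ultimately show ?thesis
    by (auto simp: fixer_block_system_def setcompr_eq_image)
qed

text \<open>The only possible \<open>E\<close> in the \<open>5/2\<close>-closure condition is the
  whole vertex set, and restricting a permutation to it changes nothing.\<close>

lemma nine_eighths_closed_Aut:
  assumes wf: "wf_digraph (with_proj D)" and con: "connected (with_proj D)"
    and fin: "finite (pverts D)" and trans: "transitive_on (pverts D) (Aut D)"
    and p: "p = (LEAST q. prime q \<and> q dvd card (pverts D))"
    and free: "\<not> has_subdigraph_iso D (oriented_complete_bipartite p)"
  shows "nine_eighths_closed (pverts D) (Aut D)"
proof -
  have fixer: "fixer_block_system (pverts D) H \<B> = {pverts D}"
    if "subgroup H (perm_group (pverts D) (Aut D))" "normal_block_system (pverts D) H \<B>" for H \<B>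
    using fixer_block_system_Aut[OF wf con fin p free that] .
  have "restrict_perm (pverts D) g (pverts D) = g" if "g \<in> Aut D" for g
    using that
    by (auto simp: Aut_def Bij_def restrict_perm_def restrict_def extensional_def fun_eq_iff)
  then have "five_halves_closed (pverts D) (Aut D)"
    by (simp add: five_halves_closed_def fixer)
  then show ?thesis
    using fin trans subgroup_Aut fixer by (simp add: nine_eighths_closed_def)
qed

subsection \<open>Double coset digraphs\<close>

lemma (in group) wf_coset_digraph:
  assumes "S \<subseteq> carrier G"
  shows "wf_digraph (with_proj (coset_digraph G H S))"
  by unfold_locales (use assms in \<open>fastforce simp: coset_digraph_def LCOSETS_def\<close>)+

lemma (in group) lcosets_mult:
  assumes "subgroup H G" "a \<in> carrier G" "C \<in> lcosets H"
  shows "a <#\<^bsub>G\<^esub> C \<in> lcosets H" "inv a <#\<^bsub>G\<^esub> (a <#\<^bsub>G\<^esub> C) = C"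
proof -
  obtain g where g: "g \<in> carrier G" "C = g <#\<^bsub>G\<^esub> H"
    using assms(3) by (auto simp: LCOSETS_def)
  have H: "H \<subseteq> carrier G"
    using subgroup.subset[OF assms(1)] .
  show "a <#\<^bsub>G\<^esub> C \<in> lcosets H"
    using g assms(2) by (auto simp: LCOSETS_def lcos_m_assoc[OF H])
  show "inv a <#\<^bsub>G\<^esub> (a <#\<^bsub>G\<^esub> C) = C"
    using g assms(2) by (simp add: lcos_m_assoc[OF H] m_assoc[symmetric])
qed

text \<open>Left translation by \<open>a\<close> replaces the representative \<open>g\<close> by
  \<open>a \<otimes> g\<close> and keeps the same \<open>s\<close> in \<open>S\<close>.\<close>

lemma (in group) coset_digraph_arc_mult:
  assumes "subgroup H G" "S \<subseteq> carrier G" "a \<in> carrier G" "(u, v) \<in> parcs (coset_digraph G H S)"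
  shows "(a <#\<^bsub>G\<^esub> u, a <#\<^bsub>G\<^esub> v) \<in> parcs (coset_digraph G H S)"
proof -
  obtain g s where gs: "g \<in> carrier G" "s \<in> S" "u = g <#\<^bsub>G\<^esub> H" "v = (g \<otimes> s) <#\<^bsub>G\<^esub> H"
    using assms(4) by (auto simp: coset_digraph_def)
  have H: "H \<subseteq> carrier G"
    using subgroup.subset[OF assms(1)] .
  have s: "s \<in> carrier G"
    using gs(2) assms(2) by blast
  have "a <#\<^bsub>G\<^esub> u = (a \<otimes> g) <#\<^bsub>G\<^esub> H" "a <#\<^bsub>G\<^esub> v = (a \<otimes> g \<otimes> s) <#\<^bsub>G\<^esub> H"
    using gs assms(3) s by (simp_all add: lcos_m_assoc[OF H] m_assoc)
  then show ?thesis
    using gs(1,2) assms(3) unfolding coset_digraph_def by auto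
qed

text \<open>Translation by \<open>inv a\<close> is the inverse map; since it also preserves arcs,
  arcs are reflected as well.\<close>

lemma (in group) lcos_mult_in_Aut:
  assumes "subgroup H G" "S \<subseteq> carrier G" "a \<in> carrier G"
  shows "(\<lambda>C\<in>lcosets H. a <#\<^bsub>G\<^esub> C) \<in> Aut (coset_digraph G H S)"
proof -
  let ?D = "coset_digraph G H S"
  have inv: "a <#\<^bsub>G\<^esub> (inv a <#\<^bsub>G\<^esub> C) = C" if "C \<in> lcosets H" for C
    using lcosets_mult(2)[OF assms(1) inv_closed[OF assms(3)] that] assms(3) by simp
  have "bij_betw (\<lambda>C\<in>lcosets H. a <#\<^bsub>G\<^esub> C) (lcosets H) (lcosets H)"
    by (rule bij_betw_byWitness[where f' = "\<lambda>C. inv a <#\<^bsub>G\<^esub> C"])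
      (use lcosets_mult[OF assms(1)] assms(3) inv in auto)
  then have "(\<lambda>C\<in>lcosets H. a <#\<^bsub>G\<^esub> C) \<in> Bij (lcosets H)"
    by (simp add: Bij_def)
  moreover have "(a <#\<^bsub>G\<^esub> u, a <#\<^bsub>G\<^esub> v) \<in> parcs ?D \<longleftrightarrow> (u, v) \<in> parcs ?D"
    if "u \<in> lcosets H" "v \<in> lcosets H" for u v
    using coset_digraph_arc_mult[OF assms, of u v]
      coset_digraph_arc_mult[OF assms(1,2) inv_closed[OF assms(3)], of "a <#\<^bsub>G\<^esub> u" "a <#\<^bsub>G\<^esub> v"]
      lcosets_mult(2)[OF assms(1,3)] that by auto
  moreover have "pverts ?D = lcosets H"
    by (simp add: coset_digraph_def)
  ultimately show ?thesis
    by (simp add: Aut_def)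
qed

lemma (in group) transitive_on_Aut_coset_digraph:
  assumes "subgroup H G" "S \<subseteq> carrier G"
  shows "transitive_on (lcosets H) (Aut (coset_digraph G H S))"
proof (rule transitive_onI)
  show "subgroup (Aut (coset_digraph G H S)) (BijGroup (lcosets H))"
    using subgroup_Aut[of "coset_digraph G H S"] by (simp add: coset_digraph_def)
  fix x y
  assume xy: "x \<in> lcosets H" "y \<in> lcosets H"
  obtain g h where gh: "g \<in> carrier G" "x = g <#\<^bsub>G\<^esub> H" "h \<in> carrier G" "y = h <#\<^bsub>G\<^esub> H"
    using xy by (auto simp: LCOSETS_def)
  \<comment> \<open>Translation by this element takes the coset of \<open>g\<close> to the coset of
    \<open>h\<close>.\<close>
  have "(h \<otimes> inv g) <#\<^bsub>G\<^esub> x = y"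
    using gh subgroup.subset[OF assms(1)] by (simp add: lcos_m_assoc m_assoc)
  then show "\<exists>f\<in>Aut (coset_digraph G H S). f x = y"
    using lcos_mult_in_Aut[OF assms, of "h \<otimes> inv g"] gh(1,3) xy(1)
    by (intro bexI[of _ "\<lambda>C\<in>lcosets H. (h \<otimes> inv g) <#\<^bsub>G\<^esub> C"]) auto
qed

theorem theorem5p14:
  fixes G :: "('g, 'm) monoid_scheme" and H S :: "'g set" and n p :: nat
  assumes "group G"
    and "subgroup H G"
    and "S \<subseteq> carrier G"
    and "S \<inter> H = {}"
    and "S = H <#>\<^bsub>G\<^esub> S <#>\<^bsub>G\<^esub> H"
    and "finite (lcosets\<^bsub>G\<^esub> H)"
    and "n = card (lcosets\<^bsub>G\<^esub> H)"
    and "n \<ge> 2"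
    and "p = (LEAST q. prime q \<and> q dvd n)"
  shows "(connected (with_proj (coset_digraph G H S)) \<and>
           \<not> has_subdigraph_iso (coset_digraph G H S) (oriented_complete_bipartite p)
         \<longrightarrow> nine_eighths_closed (lcosets\<^bsub>G\<^esub> H) (Aut (coset_digraph G H S))) \<and>
         (symmetric (with_proj (coset_digraph G H S)) \<and>
           connected (with_proj (coset_digraph G H S)) \<and>
           girth (coset_digraph G H S) \<ge> 5
         \<longrightarrow> nine_eighths_closed (lcosets\<^bsub>G\<^esub> H) (Aut (coset_digraph G H S)))"
proof -
  interpret group G
    by fact
  let ?D = "coset_digraph G H S"
  have V: "pverts ?D = lcosets\<^bsub>G\<^esub> H"
    by (simp add: coset_digraph_def)
  have closed: "nine_eighths_closed (lcosets\<^bsub>G\<^esub> H) (Aut ?D)"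
    if "connected (with_proj ?D)" "\<not> has_subdigraph_iso ?D (oriented_complete_bipartite p)"
    using nine_eighths_closed_Aut[of ?D p] wf_coset_digraph transitive_on_Aut_coset_digraph
      that assms(2,3,6,7,9) V by auto
  \<comment> \<open>Because \<open>n\<close> is at least 2, the \<open>LEAST\<close> is attained and
    \<open>p\<close> is a prime. Then \<open>p\<close> is at least 2, as the 4-cycle
    requires.\<close>
  have "\<exists>q. prime q \<and> q dvd n"
    using prime_factor_nat[of n] assms(8) by auto
  then have "prime p"
    unfolding assms(9) by (rule LeastI2_ex) simp
  have "\<not> has_subdigraph_iso ?D (oriented_complete_bipartite p)"
    if "symmetric (with_proj ?D)" "girth ?D \<ge> 5"
  proof
    assume "has_subdigraph_iso ?D (oriented_complete_bipartite p)"
    then have "girth ?D \<le> 4"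
      using girth_le_4_if_oriented_complete_bipartite[OF that(1)] prime_ge_2_nat[OF \<open>prime p\<close>]
      by blast
    then have "(5::enat) \<le> 4"
      using that(2) by (rule order_trans[rotated])
    then show False
      by simp
  qed
  then show ?thesis
    using closed by blast
qed

end
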